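(* Let $f:\mathbb{R}^n\to\mathbb{R}\cup\{+\infty\}$ be a proper function, let $\bar{x}\in\operatorname{dom}(f)$ and let $\epsilon>0$. Define $l_{\bar{x}}(s)=\epsilon-f(\bar{x})+\langle s,\bar{x}\rangle$ and $m(s)=\min\{f^{\ast}(s),l_{\bar{x}}(s)\}$ for $s\in\mathbb{R}^n$. Then $$\partial_{\epsilon}f(\bar{x})=\{s\in\mathbb{R}^n : m(s)=f^{\ast}(s)\}.$$
   Context: For $f:\mathbb{R}^n\to\mathbb{R}\cup\{+\infty\}$, $\operatorname{dom}(f)=\{x: f(x)\in\mathbb{R}\}$, and $f$ is proper if $\operatorname{dom}(f)\neq\emptyset$. The Fenchel conjugate of $f$ (not necessarily convex) is $f^{\ast}(s)=\sup_{x\in\mathbb{R}^n}\{\langle s,x\rangle-f(x)\}$, with values in $\mathbb{R}\cup\{+\infty\}$. For $x\in\operatorname{dom}(f)$ and $\epsilon\ge 0$, the $\epsilon$-subdifferential of $f$ at $x$ is $$\partial_\epsilon f(x)=\{s\in\mathbb{R}^n : f(y)\ge f(x)+\langle s,y-x\rangle-\epsilon\ \text{ for all } y\in\mathbb{R}^n\};$$ the same formula is used whether or not $f$ is convex. *)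

theory Defs
  imports "HOL-Analysis.Analysis"
begin

text \<open>
  A function with values in the reals extended by plus infinity is a function into
  \<^typ>\<open>ereal\<close> that never takes the value minus infinity; that condition is stated as a
  separate hypothesis wherever such a function is introduced.
\<close>

definition eff_dom :: "('a \<Rightarrow> ereal) \<Rightarrow> 'a set" where
  "eff_dom f = {x. \<exists>r::real. f x = ereal r}"

definition proper :: "('a \<Rightarrow> ereal) \<Rightarrow> bool" where
  "proper f \<longleftrightarrow> eff_dom f \<noteq> {}"

text \<open>
  Points where \<open>f\<close> is plus infinity contribute minus infinity to the supremum, since
  a real number minus plus infinity is minus infinity in \<^typ>\<open>ereal\<close>.
\<close>

definition fenchel_conjugate :: "(real ^ 'n \<Rightarrow> ereal) \<Rightarrow> real ^ 'n \<Rightarrow> ereal" where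
  "fenchel_conjugate f s = (SUP x. ereal (s \<bullet> x) - f x)"

text \<open>
  The next two definitions are meant only for a base point in \<^term>\<open>eff_dom f\<close>; there
  \<^term>\<open>f x\<close> is a real number, so no sum below combines opposite infinities.
\<close>

definition eps_subdifferential ::
    "real \<Rightarrow> (real ^ 'n \<Rightarrow> ereal) \<Rightarrow> real ^ 'n \<Rightarrow> (real ^ 'n) set" where
  "eps_subdifferential \<epsilon> f x =
     {s. \<forall>y. f y \<ge> f x + ereal (s \<bullet> (y - x)) - ereal \<epsilon>}"

definition l_fun :: "real \<Rightarrow> (real ^ 'n \<Rightarrow> ereal) \<Rightarrow> real ^ 'n \<Rightarrow> real ^ 'n \<Rightarrow> ereal" where
  "l_fun \<epsilon> f x s = ereal \<epsilon> - f x + ereal (s \<bullet> x)"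

definition m_fun :: "real \<Rightarrow> (real ^ 'n \<Rightarrow> ereal) \<Rightarrow> real ^ 'n \<Rightarrow> real ^ 'n \<Rightarrow> ereal" where
  "m_fun \<epsilon> f x s = min (fenchel_conjugate f s) (l_fun \<epsilon> f x s)"

end

theory Submission
  imports Defs
begin

text \<open>
  The equation \<open>m(s) = f\<^sup>*(s)\<close> says that \<open>f\<^sup>*(s) \<le> l(s)\<close>, and a supremum lies below \<open>l(s)\<close>
  iff each term \<open>\<langle>s, y\<rangle> - f(y)\<close> does. Moving \<open>f(y)\<close> to one side and the remaining terms to
  the other turns that term's bound into the \<open>\<epsilon>\<close>-subgradient inequality at \<open>y\<close>.
  The delicate point is this rearrangement in the extended reals: it is legitimate
  because \<open>f(xbar)\<close> is finite and \<open>f(y)\<close> is real or \<open>+\<infinity>\<close>, and in the latter case both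
  inequalities hold.
\<close>

theorem proposition3p1:
  fixes f :: "real ^ 'n \<Rightarrow> ereal" and xbar :: "real ^ 'n" and \<epsilon> :: real
  assumes "\<And>x. f x \<noteq> -\<infinity>"
    and "proper f"
    and "xbar \<in> eff_dom f"
    and "\<epsilon> > 0"
  shows "eps_subdifferential \<epsilon> f xbar = {s. m_fun \<epsilon> f xbar s = fenchel_conjugate f s}"
proof -
  obtain r where r: "f xbar = ereal r"
    using assms(3) by (auto simp: eff_dom_def)
  have rearrange: "f xbar + ereal (s \<bullet> (y - xbar)) - ereal \<epsilon> \<le> f y
      \<longleftrightarrow> ereal (s \<bullet> y) - f y \<le> l_fun \<epsilon> f xbar s" for s y
    using assms(1)[of y] by (cases "f y") (auto simp: r l_fun_def inner_diff_right)
  have "s \<in> eps_subdifferential \<epsilon> f xbar \<longleftrightarrow> fenchel_conjugate f s \<le> l_fun \<epsilon> f xbar s" for s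
    unfolding eps_subdifferential_def fenchel_conjugate_def SUP_le_iff mem_Collect_eq rearrange
    by blast
  then show ?thesis
    unfolding m_fun_def min.absorb_iff1[symmetric] by blast
qed

end
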